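(* For every nonnegative integer $n$, $$4E_n(x)+3\sum_{k=1}^{\lfloor n/6\rfloor}\binom n{6k}E_{n-6k}(x)=x^n+(x-1)^n+(-1)^nV_n(1-2x,\,x^2-x+1).$$
   Context: The Euler polynomials $E_n(x)$ are defined by $\frac{2e^{xt}}{e^t+1}=\sum_{n\ge0}E_n(x)\frac{t^n}{n!}$ ($|t|<\pi$). For numbers $b,c$, the Lucas sequence $V_n(b,c)$ is defined by $V_0(b,c)=2$, $V_1(b,c)=b$, $V_{n+1}(b,c)=bV_n(b,c)-cV_{n-1}(b,c)$ for $n\ge1$. $\lfloor y\rfloor$ denotes the greatest integer not exceeding $y$. *)

theory Defs
  imports "HOL-Complex_Analysis.Complex_Analysis"
begin

(* The value E_n(x), read off from the generating function
     2 e^(x t) / (e^t + 1) = (\<Sum>n. E_n(x) t^n / n!)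
   as a formal power series in t.  The denominator has constant term 2, so the division is
   the proper one.  The analytic reading for |t| < pi is euler_poly_sums below. *)
definition euler_poly :: "nat \<Rightarrow> 'a \<Rightarrow> 'a :: field_char_0" where
  "euler_poly n x = fact n * fps_nth (2 * fps_exp x / (fps_exp 1 + 1)) n"

fun lucas_V :: "'a \<Rightarrow> 'a \<Rightarrow> nat \<Rightarrow> 'a :: comm_ring_1" where
  "lucas_V b c 0 = 2"
| "lucas_V b c (Suc 0) = b"
| "lucas_V b c (Suc (Suc n)) = b * lucas_V b c (Suc n) - c * lucas_V b c n"

lemma exp_neq_minus_one:
  fixes t :: complex
  assumes "norm t < pi"
  shows "exp t + 1 \<noteq> 0"
proof
  assume "exp t + 1 = 0"
  then have "exp t = exp (\<i> * of_real pi)"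
    by (simp add: add_eq_0_iff2)
  then obtain n :: int where "t = \<i> * of_real pi + (of_int (2 * n) * pi) * \<i>"
    unfolding exp_eq by blast
  then have "t = of_real (of_int (2 * n + 1) * pi) * \<i>"
    by (simp add: algebra_simps)
  then have "norm t = \<bar>of_int (2 * n + 1)\<bar> * pi"
    by (simp only: norm_mult norm_of_real norm_ii abs_mult) simp
  moreover have "\<bar>of_int (2 * n + 1) :: real\<bar> \<ge> 1"
  proof -
    have "\<bar>2 * n + 1\<bar> \<ge> 1"
      by presburger
    then show ?thesis
      by (metis of_int_1_le_iff of_int_abs)
  qed
  ultimately show False
    using assms mult_right_mono[of 1 "\<bar>of_int (2 * n + 1) :: real\<bar>" pi] by simp
qed

lemma euler_poly_sums:
  fixes x t :: complex
  assumes "norm t < pi"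
  shows "(\<lambda>n. euler_poly n x * t ^ n / fact n) sums (2 * exp (x * t) / (exp t + 1))"
proof -
  let ?f = "\<lambda>t. 2 * exp (x * t) / (exp t + 1)"
  have "?f has_fps_expansion (2 * fps_exp x / (fps_exp 1 + 1))"
    by (intro has_fps_expansion_divide' fps_expansion_intros) auto
  moreover have "?f holomorphic_on eball 0 (ereal pi)"
    by (intro holomorphic_intros) (auto simp: in_eball_iff exp_neq_minus_one)
  ultimately have "(\<lambda>n. fps_nth (2 * fps_exp x / (fps_exp 1 + 1)) n * t ^ n) sums ?f t"
    by (rule has_fps_expansion_imp_sums_complex) (use assms in simp)
  then show ?thesis
    by (simp add: euler_poly_def)
qed

end

theory Submission
  imports Defs
begin

text \<open>
  Let \<open>S(t) = (\<Sum>k. t^(6k)/(6k)!)\<close>. The left-hand side has exponential generating function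
  \<open>2 e^(xt)/(e^t + 1) * (1 + 3 S(t))\<close>. If \<open>\<omega>\<close> is a primitive cube root of unity, then
  \<open>(-1)^n V_n(1-2x, x^2-x+1) = (x+\<omega>)^n + (x+\<omega>^2)^n\<close>, so the right-hand side has generating function
  \<open>e^(xt) (1 + e^(-t) + e^(\<omega>t) + e^(\<omega>^2 t))\<close>. Multiplying by \<open>e^t + 1\<close> and using
  \<open>1 + \<omega> = -\<omega>^2\<close> produces \<open>e^(xt)\<close> times two plus the sum of
  \<open>e^(\<zeta>t)\<close> over the sixth roots of unity \<open>\<zeta>\<close>, and that sum is \<open>6 S(t)\<close>.
  Since the field need not contain \<open>\<omega>\<close>, the sum \<open>e^(\<omega>t) + e^(\<omega>^2 t)\<close> is handled as the
  exponential generating function of a Lucas sequence, characterised by its differential equation.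
\<close>

lemma lucas_V_uminus: "lucas_V (- b) c n = (- 1) ^ n * lucas_V b c n"
  by (induction b c n rule: lucas_V.induct) (simp_all add: algebra_simps)

text \<open>This is the n-th power sum of the sixth roots of unity: the last two terms belong to the
  roots of \<open>z^2 - z + 1\<close> and of \<open>z^2 + z + 1\<close>. No roots are needed in the
  ring, since every term has period six in \<open>n\<close>.\<close>

lemma sixth_roots_power_sum:
  "1 + (- 1) ^ n + lucas_V 1 1 n + lucas_V (- 1) 1 n = (if 6 dvd n then 6 else 0 :: 'a :: comm_ring_1)"
proof -
  have per: "lucas_V b 1 (6 + n) = lucas_V b (1 :: 'a) n" if "b = 1 \<or> b = - 1" for b n
    using that by (auto simp: eval_nat_numeral)
  have "lucas_V b 1 (6 * q + n) = lucas_V b (1 :: 'a) n" if "b = 1 \<or> b = - 1" for b q n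
    by (induction q) (use per[OF that] in \<open>simp_all add: add.assoc\<close>)
  then have V: "lucas_V b (1 :: 'a) n = lucas_V b 1 (n mod 6)" if "b = 1 \<or> b = - 1" for b
    using that by (metis mult_div_mod_eq)
  have sgn: "(- 1 :: 'a) ^ n = (- 1) ^ (n mod 6)"
  proof -
    have "(- 1 :: 'a) ^ (6 * (n div 6) + n mod 6) = (- 1) ^ (n mod 6)"
      unfolding power_add power_mult by simp
    then show ?thesis
      by simp
  qed
  have "1 + (- 1) ^ m + lucas_V 1 1 m + lucas_V (- 1) 1 m = (if m = 0 then 6 else 0 :: 'a)"
    if "m < 6" for m :: nat
  proof -
    from that consider "m = 0" | "m = 1" | "m = 2" | "m = 3" | "m = 4" | "m = 5"
      by linarith
    then show ?thesis
      by cases (simp_all add: eval_nat_numeral)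
  qed
  from this[of "n mod 6"]
  have "1 + (- 1) ^ (n mod 6) + lucas_V 1 1 (n mod 6) + lucas_V (- 1) 1 (n mod 6) =
      (if n mod 6 = 0 then 6 else 0 :: 'a)"
    by simp
  then show ?thesis
    using V[of 1] V[of "- 1"] sgn by (simp only: dvd_eq_mod_eq_0 simp_thms)
qed

lemma fps_deriv_egf:
  "fps_deriv (Abs_fps (\<lambda>n. u n / fact n :: 'a :: field_char_0)) = Abs_fps (\<lambda>n. u (Suc n) / fact n)"
  by (rule fps_ext) (simp add: field_simps del: of_nat_Suc)

text \<open>Stands in for \<open>e^(\<alpha>t) + e^(\<beta>t)\<close>, where \<alpha> and \<beta>
  are the roots of \<open>z^2 - b z + c\<close>.\<close>

definition lucas_fps :: "'a \<Rightarrow> 'a \<Rightarrow> 'a :: field_char_0 fps" where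
  "lucas_fps b c = Abs_fps (\<lambda>n. lucas_V b c n / fact n)"

lemma fps_nth_lucas_fps: "fps_nth (lucas_fps b c) n = lucas_V b c n / fact n"
  by (simp add: lucas_fps_def)

lemma fps_deriv2_lucas_fps:
  "fps_deriv (fps_deriv (lucas_fps b c)) =
     fps_const b * fps_deriv (lucas_fps b c) - fps_const c * lucas_fps b c"
  by (rule fps_ext) (simp add: lucas_fps_def fps_deriv_egf diff_divide_distrib)

text \<open>Differentiation shifts the sequence \<open>fact n * fps_nth F n\<close>, so the equation
  is the Lucas recurrence for it.\<close>

lemma lucas_fps_unique:
  assumes ode: "fps_deriv (fps_deriv F) = fps_const b * fps_deriv F - fps_const c * F"
    and F0: "fps_nth F 0 = 2" and F1: "fps_nth F 1 = b"
  shows "F = lucas_fps b c"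
proof -
  have "fact n * fps_nth F n = lucas_V b c n" for n
  proof (induction n rule: less_induct)
    case (less n)
    consider "n = 0" | "n = 1" | m where "n = Suc (Suc m)"
      by (metis One_nat_def not0_implies_Suc)
    then show ?case
    proof cases
      case 3
      have "fps_nth (fps_deriv (fps_deriv F)) m =
          b * (of_nat (Suc m) * fps_nth F (Suc m)) - c * fps_nth F m"
        by (simp add: ode)
      then have "fact m * (of_nat (Suc m) * (of_nat (Suc (Suc m)) * fps_nth F n)) =
          fact m * (b * (of_nat (Suc m) * fps_nth F (Suc m)) - c * fps_nth F m)"
        using 3 by simp
      then have "fact n * fps_nth F n =
          b * (fact (Suc m) * fps_nth F (Suc m)) - c * (fact m * fps_nth F m)"
        using 3 by (simp add: algebra_simps)
      also have "\<dots> = lucas_V b c n"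
        using 3 less[of m] less[of "Suc m"] by simp
      finally show ?thesis .
    qed (use F0 F1 in simp_all)
  qed
  then show ?thesis
    by (intro fps_ext) (simp add: fps_nth_lucas_fps eq_divide_eq mult.commute)
qed

text \<open>Multiplying by \<open>e^(at)\<close> shifts both characteristic roots by
  \<open>a\<close>; the new parameters are the sum and product of the shifted roots.\<close>

lemma fps_exp_times_lucas_fps:
  "fps_exp a * lucas_fps b c = lucas_fps (b + 2 * a) (c + a * b + a\<^sup>2)"
proof (rule lucas_fps_unique)
  let ?E = "fps_exp a" and ?L = "lucas_fps b c" and ?a = "fps_const a"
  have c: "fps_const (b + 2 * a) = fps_const b + 2 * ?a"
    "fps_const (c + a * b + a\<^sup>2) = fps_const c + ?a * fps_const b + ?a\<^sup>2"
    by (simp_all add: fps_const_power numeral_fps_const flip: fps_const_add fps_const_mult)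
  show "fps_deriv (fps_deriv (?E * ?L)) = fps_const (b + 2 * a) * fps_deriv (?E * ?L)
      - fps_const (c + a * b + a\<^sup>2) * (?E * ?L)"
    unfolding c
    by (simp add: fps_deriv2_lucas_fps algebra_simps power2_eq_square
        del: fps_const_add fps_const_mult)
qed (simp_all add: fps_mult_nth fps_nth_lucas_fps)

lemma six_section_generating_function:
  "6 * Abs_fps (\<lambda>n. if 6 dvd n then 1 / fact n else 0) =
     fps_exp 1 + fps_exp (- 1) + lucas_fps 1 1 + lucas_fps (- 1) (1 :: 'a :: field_char_0)"
proof (rule fps_ext)
  fix n
  have "(if 6 dvd n then 6 else 0 :: 'a) / fact n =
      1 / fact n + (- 1) ^ n / fact n + lucas_V 1 1 n / fact n + lucas_V (- 1) 1 n / fact n"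
    by (simp flip: sixth_roots_power_sum add: add_divide_distrib)
  then show "fps_nth (6 * Abs_fps (\<lambda>n. if 6 dvd n then 1 / fact n else 0)) n =
      fps_nth (fps_exp 1 + fps_exp (- 1) + lucas_fps 1 1 + lucas_fps (- 1) (1 :: 'a)) n"
    by (simp add: fps_nth_lucas_fps numeral_fps_const split: if_splits)
qed

theorem theorem3p3:
  fixes x :: "'a :: field_char_0" and n :: nat
  shows "4 * euler_poly n x
           + 3 * (\<Sum>k = 1..n div 6. of_nat (n choose (6 * k)) * euler_poly (n - 6 * k) x)
         = x ^ n + (x - 1) ^ n + (-1) ^ n * lucas_V (1 - 2 * x) (x\<^sup>2 - x + 1) n"
proof -
  define E :: "'a fps" where "E = fps_exp 1"
  define S :: "'a fps" where "S = Abs_fps (\<lambda>n. if 6 dvd n then 1 / fact n else 0)"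
  define P where "P = 2 * fps_exp x / (E + 1)"
  define L where "L = lucas_fps (2 * x - 1) (x\<^sup>2 - x + 1)"
  have unit: "fps_nth (E + 1) 0 \<noteq> 0"
    by (simp add: E_def)
  have P: "P * (E + 1) = 2 * fps_exp x"
    unfolding P_def using unit by (simp add: fps_divide_unit mult.assoc inverse_mult_eq_1)
  have Lx: "L = fps_exp x * lucas_fps (- 1) 1"
    by (simp add: L_def fps_exp_times_lucas_fps algebra_simps)
  \<comment> \<open>Adding 1 turns the primitive cube roots of unity into the primitive sixth
    roots.\<close>
  have L1: "E * lucas_fps (- 1) 1 = lucas_fps 1 1"
    by (simp add: E_def fps_exp_times_lucas_fps)
  have E1: "E * fps_exp (- 1) = 1"
    by (simp add: E_def flip: fps_exp_add_mult)
  have ex: "fps_exp (x - 1) = fps_exp x * fps_exp (- 1)"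
    by (simp flip: fps_exp_add_mult)
  have "P * (1 + 3 * S) * (E + 1) = fps_exp x * (2 + 6 * S)"
    using P by algebra
  also have "\<dots> = fps_exp x * (2 + (E + fps_exp (- 1) + E * lucas_fps (- 1) 1 + lucas_fps (- 1) 1))"
    unfolding S_def six_section_generating_function L1 by (simp add: E_def)
  also have "\<dots> = (fps_exp x + fps_exp (x - 1) + L) * (E + 1)"
    unfolding ex Lx using E1 by algebra
  finally have gf: "P * (1 + 3 * S) = fps_exp x + fps_exp (x - 1) + L"
    using unit by (metis fps_zero_nth mult_right_cancel)
  have PS: "fact n * fps_nth (P * S) n =
      (\<Sum>k = 0..n div 6. of_nat (n choose (6 * k)) * euler_poly (n - 6 * k) x)"
  proof -
    have "fact n * fps_nth (P * S) n = (\<Sum>i = 0..n. fact n * (fps_nth S i * fps_nth P (n - i)))"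
      by (simp add: mult.commute[of P] fps_mult_nth sum_distrib_left)
    \<comment> \<open>The coefficients of \<open>S\<close> vanish off the multiples of 6.\<close>
    also have "\<dots> = (\<Sum>i \<in> (*) 6 ` {0..n div 6}. fact n * (fps_nth S i * fps_nth P (n - i)))"
      by (rule sum.mono_neutral_right) (auto simp: S_def elim!: dvdE)
    also have "\<dots> = (\<Sum>k = 0..n div 6. fact n * (fps_nth S (6 * k) * fps_nth P (n - 6 * k)))"
      by (subst sum.reindex) (auto simp: inj_on_def)
    also have "\<dots> = (\<Sum>k = 0..n div 6. of_nat (n choose (6 * k)) * euler_poly (n - 6 * k) x)"
      by (rule sum.cong) (auto simp: S_def P_def E_def euler_poly_def binomial_fact)
    finally show ?thesis .
  qed
  \<comment> \<open>The sum in \<open>PS\<close> starts at \<open>k = 0\<close>; that term supplies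
    three of the four copies of \<open>euler_poly n x\<close>.\<close>
  have "4 * euler_poly n x
      + 3 * (\<Sum>k = 1..n div 6. of_nat (n choose (6 * k)) * euler_poly (n - 6 * k) x)
    = euler_poly n x + 3 * (fact n * fps_nth (P * S) n)"
    unfolding PS by (simp add: sum.atLeast_Suc_atMost algebra_simps)
  also have "\<dots> = fact n * fps_nth (P + fps_const 3 * (P * S)) n"
    by (simp add: P_def E_def euler_poly_def distrib_left)
  also have "P + fps_const 3 * (P * S) = P * (1 + 3 * S)"
    by (simp add: algebra_simps flip: numeral_fps_const)
  also have "fact n * fps_nth (P * (1 + 3 * S)) n = x ^ n + (x - 1) ^ n + lucas_V (2 * x - 1) (x\<^sup>2 - x + 1) n"
    unfolding gf by (simp add: L_def fps_nth_lucas_fps field_simps)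
  also have "lucas_V (2 * x - 1) (x\<^sup>2 - x + 1) n =
      (- 1) ^ n * lucas_V (1 - 2 * x) (x\<^sup>2 - x + 1) n"
    using lucas_V_uminus[of "1 - 2 * x"] by simp
  finally show ?thesis .
qed

end
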